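(* Let $e,k,j\ge 1$ be integers with $j+k\le e-1$, $e-k\ge 4$ and $k\le \frac e2$. If $(j,k)\ne(1,\frac e2)$, then the numerical semigroup $S^e_k(j)$ is symmetric if and only if $j=k$. If $(j,k)=(1,\frac e2)$, then $S^e_k(j)$ is symmetric.
   Context: $S^e_k(j)=\langle e,e+1,\ldots,e+j-1,\,e+j+k,\ldots,2e-1\rangle$ is the numerical semigroup of multiplicity $e$ and width $e-1$ obtained by deleting the $k$ consecutive generators $e+j,\ldots,e+j+k-1$ from $[e,2e-1]$. A numerical semigroup with genus $g$ (number of gaps, i.e. nonnegative integers not in it) and Frobenius number $F$ (largest gap) is symmetric iff $2g=F+1$. *)

theory Defs
  imports Complex_Main
begin

inductive_set generated_monoid :: "nat set \<Rightarrow> nat set" for A :: "nat set" where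
  zero: "0 \<in> generated_monoid A"
| incl: "a \<in> A \<Longrightarrow> a \<in> generated_monoid A"
| add: "x \<in> generated_monoid A \<Longrightarrow> y \<in> generated_monoid A \<Longrightarrow> x + y \<in> generated_monoid A"

definition gaps :: "nat set \<Rightarrow> nat set" where
  "gaps S = - S"

definition numerical_semigroup :: "nat set \<Rightarrow> bool" where
  "numerical_semigroup S \<longleftrightarrow>
     0 \<in> S \<and> (\<forall>x\<in>S. \<forall>y\<in>S. x + y \<in> S) \<and> finite (gaps S)"

definition genus :: "nat set \<Rightarrow> nat" where
  "genus S = card (gaps S)"

text \<open>The Frobenius number is integer-valued so that the semigroup of all natural numbers,
  which has no gaps, gets the conventional value -1.\<close>

definition frobenius :: "nat set \<Rightarrow> int" where
  "frobenius S = (if gaps S = {} then - 1 else int (Max (gaps S)))"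

definition symmetric_semigroup :: "nat set \<Rightarrow> bool" where
  "symmetric_semigroup S \<longleftrightarrow>
     numerical_semigroup S \<and> 2 * int (genus S) = frobenius S + 1"

definition Sekj :: "nat \<Rightarrow> nat \<Rightarrow> nat \<Rightarrow> nat set" where
  "Sekj e k j = generated_monoid ({e..<e + j} \<union> {e + j + k..<2 * e})"

text \<open>The first conjunct of \<^const>\<open>symmetric_semigroup\<close> always holds for the semigroups
  considered here.\<close>

lemma generated_monoid_mult:
  "a \<in> generated_monoid A \<Longrightarrow> n * a \<in> generated_monoid A"
  by (induction n) (auto intro: generated_monoid.intros)

lemma numerical_semigroup_Sekj:
  assumes "j \<ge> 1" and "j + k \<le> e - 1" and "e \<ge> 1"
  shows "numerical_semigroup (Sekj e k j)"
proof -
  let ?S = "Sekj e k j"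
  have e: "e \<in> ?S" and f: "2 * e - 1 \<in> ?S"
    using assms unfolding Sekj_def by (auto intro!: generated_monoid.incl)
  have "n \<in> ?S" if n: "n \<ge> 2 * e * e" for n
  proof -
    define q r where "q = n div e" and "r = n mod e"
    have nqr: "n = q * e + r" by (simp add: q_def r_def)
    have r: "r < e" using assms(3) by (simp add: r_def)
    have q: "q \<ge> 2 * e"
      using n assms(3) by (simp add: q_def less_eq_div_iff_mult_less_eq)
    obtain d where d: "q = 2 * e + d" using q le_Suc_ex by blast
    have "int n = int ((d + 1 + 2 * r) * e + (e - r) * (2 * e - 1))"
      unfolding of_nat_add of_nat_mult
      using r assms(3) by (simp add: nqr d of_nat_diff algebra_simps)
    then have eq: "n = (d + 1 + 2 * r) * e + (e - r) * (2 * e - 1)"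
      by (simp only: of_nat_eq_iff)
    show ?thesis
      using e f unfolding Sekj_def
      by (subst eq) (intro generated_monoid.add generated_monoid_mult)
  qed
  then have "gaps ?S \<subseteq> {..<2 * e * e}"
    unfolding gaps_def by (meson ComplD lessThan_iff not_le subsetI)
  then have "finite (gaps ?S)"
    by (rule finite_subset) simp
  then show ?thesis
    unfolding numerical_semigroup_def Sekj_def
    by (auto intro: generated_monoid.intros)
qed

end

theory Submission
  imports Defs
begin

text \<open>
  The proof determines every gap of \<open>Sekj e k j\<close>, after which genus and Frobenius number can be read
  off. Write \<open>L = {e..<e + j}\<close> and \<open>R = {e + j + k..<2 * e}\<close> for the two runs of generators. Since
  \<open>e\<close> is a generator, a residue class modulo \<open>e\<close> stays in the semigroup once it has entered it, and
  only the \<open>k\<close> residues \<open>j, \<dots>, j + k - 1\<close> are missing among the generators. Of these, the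
  sums \<open>L + L\<close> supply the ones up to \<open>2 * j - 2\<close>, between \<open>2 * e\<close> and \<open>3 * e\<close>. The sums
  \<open>L + R\<close> supply none of the missing ones. The sums \<open>R + R\<close> start at \<open>2 * e + 2 * j + 2 * k\<close>, and because of
  \<open>2 * k \<le> e\<close> they supply between \<open>3 * e\<close> and \<open>4 * e\<close> all that is still missing, with at most one
  exception: if \<open>e = 2 * k\<close>, the number \<open>3 * e + 2 * j - 1\<close> lies just below \<open>R + R\<close>. It
  belongs to \<open>L + L + L\<close> if \<open>j \<ge> 2\<close>; if \<open>j = 1\<close>, then \<open>L = {e}\<close> and the residue \<open>1\<close> enters the
  semigroup only with \<open>R + R + R\<close>, at \<open>5 * e + 1\<close>.

  Hence, unless \<open>j = 1\<close> and \<open>e = 2 * k\<close>, the gaps are \<open>{1..<e}\<close>, \<open>{e + j..<e + j + k}\<close> and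
  \<open>{2 * e + 2 * j - 1..<2 * e + j + k}\<close> (lemma \<open>gaps_Sekj_generic\<close>). For \<open>j \<le> k\<close> this gives
  \<open>g = e + 2 * k - j\<close> and \<open>F = 2 * e + j + k - 1\<close>, so that \<open>2 * g = F + 1\<close> amounts to \<open>3 * k = 3 * j\<close>.
  For \<open>j > k\<close> the third interval is empty, \<open>g = e + k - 1\<close> and \<open>F = e + j + k - 1\<close>, and \<open>2 * g = F + 1\<close>
  would force \<open>j = e + k - 2\<close>, which is too large. In the exceptional case \<open>3 * e + 1\<close> and
  \<open>4 * e + 1\<close> are gaps as well (lemma \<open>gaps_Sekj_exceptional\<close>), and \<open>g = 2 * e + 1\<close>, \<open>F = 4 * e + 1\<close>.
\<close>

section \<open>Generated submonoids of the natural numbers\<close>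

lemma generated_monoid_interval_add:
  assumes "{a..b} \<subseteq> generated_monoid A" and "{c..d} \<subseteq> generated_monoid A"
    and "a \<le> b" and "c \<le> d"
  shows "{a + c..b + d} \<subseteq> generated_monoid A"
proof
  fix n assume n: "n \<in> {a + c..b + d}"
  have "min b (n - c) \<in> {a..b}" and "n - min b (n - c) \<in> {c..d}"
    using n assms(3,4) by auto
  then have "min b (n - c) + (n - min b (n - c)) \<in> generated_monoid A"
    using assms(1,2) by (blast intro: generated_monoid.add)
  then show "n \<in> generated_monoid A"
    by simp
qed

text \<open>A certificate for a conjectured set of gaps \<open>H\<close>. Its complement has to be a submonoid that
  contains the generators. For the other inclusion, subtracting the generator \<open>m\<close> reduces
  membership to the numbers outside \<open>H\<close> from which \<open>m\<close> cannot be subtracted without entering \<open>H\<close>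
  or becoming negative; these are the elements of the Apery set of \<open>m\<close>.\<close>

lemma gaps_generated_monoid_eqI:
  assumes "m \<in> A" and "m > 0"
    and "0 \<notin> H" and "A \<inter> H = {}"
    and closed: "\<And>x y. x \<notin> H \<Longrightarrow> y \<notin> H \<Longrightarrow> x + y \<notin> H"
    and apery: "\<And>n. n \<notin> H \<Longrightarrow> n < m \<or> n - m \<in> H \<Longrightarrow> n \<in> generated_monoid A"
  shows "gaps (generated_monoid A) = H"
proof -
  have "x \<notin> H" if "x \<in> generated_monoid A" for x
    using that by induction (use assms in auto)
  moreover have "n \<notin> H \<Longrightarrow> n \<in> generated_monoid A" for n
  proof (induction n rule: less_induct)
    case (less n)
    show ?case
    proof (cases "n < m \<or> n - m \<in> H")
      case True
      then show ?thesis using apery less.prems by blast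
    next
      case False
      then have "n - m \<in> generated_monoid A"
        using less.IH \<open>m > 0\<close> by simp
      then have "(n - m) + m \<in> generated_monoid A"
        using \<open>m \<in> A\<close> by (blast intro: generated_monoid.intros)
      then show ?thesis using False by simp
    qed
  qed
  ultimately show ?thesis
    unfolding gaps_def by blast
qed

section \<open>The gaps of \<open>Sekj e k j\<close>\<close>

lemma Sekj_sum_intervals:
  assumes "j \<ge> 1" and "j + k < e"
  shows "{e..e + j - 1} \<subseteq> Sekj e k j"
    and "{e + j + k..2 * e - 1} \<subseteq> Sekj e k j"
    and "{2 * e..2 * e + 2 * j - 2} \<subseteq> Sekj e k j"
    and "{3 * e..3 * e + 3 * j - 3} \<subseteq> Sekj e k j"
    and "{2 * e + 2 * j + 2 * k..4 * e - 2} \<subseteq> Sekj e k j"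
    and "{3 * e + 3 * j + 3 * k..6 * e - 3} \<subseteq> Sekj e k j"
proof -
  let ?S = "Sekj e k j"
  note sum = generated_monoid_interval_add[where A = "{e..<e + j} \<union> {e + j + k..<2 * e}",
      folded Sekj_def]
  show L: "{e..e + j - 1} \<subseteq> ?S" and R: "{e + j + k..2 * e - 1} \<subseteq> ?S"
    using assms unfolding Sekj_def by (auto intro!: generated_monoid.incl)
  have LL: "{e + e..(e + j - 1) + (e + j - 1)} \<subseteq> ?S"
    using sum[OF L L] assms by simp
  have RR: "{(e + j + k) + (e + j + k)..(2 * e - 1) + (2 * e - 1)} \<subseteq> ?S"
    using sum[OF R R] assms by simp
  have LLL: "{(e + e) + e..((e + j - 1) + (e + j - 1)) + (e + j - 1)} \<subseteq> ?S"
    using sum[OF LL L] assms by simp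
  have RRR: "{((e + j + k) + (e + j + k)) + (e + j + k)..
      ((2 * e - 1) + (2 * e - 1)) + (2 * e - 1)} \<subseteq> ?S"
    by (rule sum[OF RR R]) (use assms in linarith)+
  have eqs: "(e + j - 1) + (e + j - 1) = 2 * e + 2 * j - 2"
    "(2 * e + 2 * j - 2) + (e + j - 1) = 3 * e + 3 * j - 3"
    "(2 * e - 1) + (2 * e - 1) = 4 * e - 2"
    "(4 * e - 2) + (2 * e - 1) = 6 * e - 3"
    "e + e = 2 * e" "2 * e + e = 3 * e"
    "(e + j + k) + (e + j + k) = 2 * e + 2 * j + 2 * k"
    "(2 * e + 2 * j + 2 * k) + (e + j + k) = 3 * e + 3 * j + 3 * k"
    using assms by linarith+
  show "{2 * e..2 * e + 2 * j - 2} \<subseteq> ?S"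
    using LL by (simp only: eqs)
  show "{3 * e..3 * e + 3 * j - 3} \<subseteq> ?S"
    using LLL by (simp only: eqs)
  show "{2 * e + 2 * j + 2 * k..4 * e - 2} \<subseteq> ?S"
    using RR by (simp only: eqs)
  show "{3 * e + 3 * j + 3 * k..6 * e - 3} \<subseteq> ?S"
    using RRR by (simp only: eqs)
qed

text \<open>The third interval is what \<open>L + L\<close> leaves of the missing residues between \<open>2 * e\<close> and
  \<open>3 * e\<close>; it is empty exactly for \<open>j > k\<close>.\<close>

lemma gaps_Sekj_generic:
  assumes "j \<ge> 1" and "j + k < e" and "2 * k \<le> e" and "\<not> (j = 1 \<and> e = 2 * k)"
  shows "gaps (Sekj e k j) =
    {1..<e} \<union> {e + j..<e + j + k} \<union> {2 * e + 2 * j - 1..<2 * e + j + k}" (is "_ = ?H")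
  unfolding Sekj_def
proof (rule gaps_generated_monoid_eqI[where m = e])
  show "x + y \<notin> ?H" if x: "x \<notin> ?H" and y: "y \<notin> ?H" for x y
  proof (cases "x = 0 \<or> y = 0")
    case True
    then show ?thesis using x y by auto
  next
    case False
    then have ge: "x \<ge> e" "y \<ge> e" using x y by auto
    have "\<not> (2 * e + 2 * j - 1 \<le> x + y \<and> x + y < 2 * e + j + k)"
    proof
      assume a: "2 * e + 2 * j - 1 \<le> x + y \<and> x + y < 2 * e + j + k"
      then have "x < e + j + k" "y < e + j + k" using ge by linarith+
      then have "x < e + j" "y < e + j" using x y by auto
      then show False using a assms by linarith
    qed
    then show ?thesis using ge assms by auto
  qed
next
  fix n assume n: "n \<notin> ?H" and pred: "n < e \<or> n - e \<in> ?H"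
  have "n = 0 \<or> e \<le> n"
    using n by simp linarith
  moreover have "n < e \<or> (e < n \<and> n < 2 * e) \<or> (2 * e + j \<le> n \<and> n < 2 * e + j + k)
      \<or> (3 * e + 2 * j - 1 \<le> n \<and> n < 3 * e + j + k)"
    using pred unfolding Un_iff atLeastLessThan_iff by linarith
  ultimately consider "n = 0" | "e < n" "n < 2 * e"
    | "2 * e + j \<le> n" "n < 2 * e + j + k"
    | "3 * e + 2 * j - 1 \<le> n" "n < 3 * e + j + k"
    using assms(1,2) by linarith
  then have "n \<in> Sekj e k j"
  proof cases
    case 1
    then show ?thesis by (simp add: Sekj_def generated_monoid.zero)
  next
    case 2
    then have "n \<in> {e..e + j - 1} \<or> n \<in> {e + j + k..2 * e - 1}"
      using n by auto
    then show ?thesis using Sekj_sum_intervals(1,2)[OF assms(1,2)] by blast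
  next
    case 3
    then have "n \<in> {2 * e..2 * e + 2 * j - 2}"
      using n by auto
    then show ?thesis using Sekj_sum_intervals(3)[OF assms(1,2)] by blast
  next
    case 4
    show ?thesis
    proof (cases "2 * e + 2 * j + 2 * k \<le> n")
      case True
      then have "n \<in> {2 * e + 2 * j + 2 * k..4 * e - 2}"
        using 4 assms by auto
      then show ?thesis using Sekj_sum_intervals(5)[OF assms(1,2)] by blast
    next
      \<comment> \<open>Here \<open>e = 2 * k\<close> and \<open>n = 3 * e + 2 * j - 1\<close>, the one number just below \<open>R + R\<close>.\<close>
      case False
      then have "n = 3 * e + 2 * j - 1" and "j \<ge> 2"
        using 4 assms by linarith+
      then have "n \<in> {3 * e..3 * e + 3 * j - 3}"
        by auto
      then show ?thesis using Sekj_sum_intervals(4)[OF assms(1,2)] by blast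
    qed
  qed
  then show "n \<in> generated_monoid ({e..<e + j} \<union> {e + j + k..<2 * e})"
    by (simp add: Sekj_def)
qed (use assms in auto)

text \<open>With \<open>j = 1\<close> and \<open>e = 2 * k\<close>, the sums \<open>R + R\<close> fill \<open>{3 * e + 2..4 * e - 2}\<close>, so neither
  \<open>3 * e + 1\<close> nor \<open>4 * e + 1\<close> can be reached with at most two elements of \<open>R\<close>, whereas \<open>R + R + R\<close> starts above
  \<open>4 * e + 1\<close>.\<close>

lemma gaps_Sekj_exceptional:
  assumes "k \<ge> 2"
  shows "gaps (Sekj (2 * k) k 1) =
    {1..<2 * k} \<union> {2 * k + 1..3 * k} \<union> {4 * k + 1..5 * k} \<union> {6 * k + 1, 8 * k + 1}" (is "_ = ?H")
  unfolding Sekj_def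
proof (rule gaps_generated_monoid_eqI[where m = "2 * k"])
  show "x + y \<notin> ?H" if "x \<notin> ?H" "y \<notin> ?H" for x y
  proof (cases "x = 0 \<or> y = 0")
    case True
    then show ?thesis using that by auto
  next
    case False
    have spread: "z = 2 * k \<or> (3 * k + 1 \<le> z \<and> z \<le> 4 * k)
        \<or> (5 * k + 1 \<le> z \<and> z \<le> 6 * k) \<or> 6 * k + 2 \<le> z" if "z \<notin> ?H" "z \<noteq> 0" for z
      using that by auto
    have xy: "x = 2 * k \<or> (3 * k + 1 \<le> x \<and> x \<le> 4 * k)
        \<or> (5 * k + 1 \<le> x \<and> x \<le> 6 * k) \<or> 6 * k + 2 \<le> x"
      "y = 2 * k \<or> (3 * k + 1 \<le> y \<and> y \<le> 4 * k)
        \<or> (5 * k + 1 \<le> y \<and> y \<le> 6 * k) \<or> 6 * k + 2 \<le> y"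
      using spread that False by blast+
    have "4 * k \<le> x + y"
      using xy by (elim disjE conjE; simp)
    moreover have "\<not> (4 * k + 1 \<le> x + y \<and> x + y \<le> 5 * k)"
      using xy by (elim disjE conjE; simp)
    moreover have "x + y \<noteq> 6 * k + 1" and "x + y \<noteq> 8 * k + 1"
      using xy assms by (elim disjE conjE; simp)+
    ultimately show ?thesis by auto
  qed
next
  have e: "(1::nat) \<ge> 1" "1 + k < 2 * k" using assms by auto
  fix n assume n: "n \<notin> ?H" and pred: "n < 2 * k \<or> n - 2 * k \<in> ?H"
  have out: "n = 0 \<or> 2 * k \<le> n" "n < 2 * k + 1 \<or> 3 * k < n" "n < 4 * k + 1 \<or> 5 * k < n"
    "n \<noteq> 6 * k + 1" "n \<noteq> 8 * k + 1"
    using n by auto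
  have "n < 2 * k \<or> (2 * k + 1 \<le> n \<and> n < 4 * k) \<or> (4 * k + 1 \<le> n \<and> n \<le> 5 * k)
      \<or> (6 * k + 1 \<le> n \<and> n \<le> 7 * k) \<or> n = 8 * k + 1 \<or> n = 10 * k + 1"
    using pred unfolding Un_iff atLeastLessThan_iff atLeastAtMost_iff insert_iff empty_iff
    by (elim disjE conjE FalseE; linarith)
  with out consider "n = 0" | "3 * k + 1 \<le> n" "n < 4 * k"
    | "6 * k + 2 \<le> n" "n \<le> 7 * k" | "n = 10 * k + 1"
    by linarith
  then have "n \<in> Sekj (2 * k) k 1"
  proof cases
    case 1
    then show ?thesis by (simp add: Sekj_def generated_monoid.zero)
  next
    case 2
    then show ?thesis using Sekj_sum_intervals(2)[OF e] by auto
  next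
    case 3
    then show ?thesis using Sekj_sum_intervals(5)[OF e] assms by auto
  next
    case 4
    then show ?thesis using Sekj_sum_intervals(6)[OF e] assms by auto
  qed
  then show "n \<in> generated_monoid ({2 * k..<2 * k + 1} \<union> {2 * k + 1 + k..<2 * (2 * k)})"
    by (simp add: Sekj_def)
qed (use assms in auto)

section \<open>Genus, Frobenius number and symmetry\<close>

lemma genus_Sekj_generic:
  assumes "j \<ge> 1" and "j + k < e" and "2 * k \<le> e" and "\<not> (j = 1 \<and> e = 2 * k)"
  shows "genus (Sekj e k j) = (e - 1) + k + (k + 1 - j)"
proof -
  have "card ({1..<e} \<union> {e + j..<e + j + k} \<union> {2 * e + 2 * j - 1..<2 * e + j + k})
      = card {1..<e} + card {e + j..<e + j + k} + card {2 * e + 2 * j - 1..<2 * e + j + k}"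
    using assms(1,2) by (subst card_Un_disjoint, simp, simp, force)+ simp
  then show ?thesis
    unfolding genus_def gaps_Sekj_generic[OF assms] using assms(1) by simp
qed

lemma frobenius_eqI:
  assumes "f \<in> gaps S" and "\<And>n. n \<in> gaps S \<Longrightarrow> n \<le> f"
  shows "frobenius S = int f"
proof -
  have "finite (gaps S)"
    using assms(2) by (meson finite_nat_set_iff_bounded_le)
  then have "Max (gaps S) = f"
    using assms by (intro Max_eqI) auto
  then show ?thesis
    using assms(1) by (auto simp: frobenius_def)
qed

lemma frobenius_Sekj_generic:
  assumes "j \<ge> 1" and "k \<ge> 1" and "j + k < e" and "2 * k \<le> e" and "\<not> (j = 1 \<and> e = 2 * k)"
  shows "frobenius (Sekj e k j) = int ((if j \<le> k then 2 * e else e) + j + k - 1)"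
  by (rule frobenius_eqI;
      unfold gaps_Sekj_generic[OF assms(1,3,4,5)]; use assms in \<open>auto split: if_splits\<close>)

lemma symmetric_Sekj_generic_iff:
  assumes "j \<ge> 1" and "k \<ge> 1" and "j + k < e" and "2 * k \<le> e" and "\<not> (j = 1 \<and> e = 2 * k)"
  shows "symmetric_semigroup (Sekj e k j) \<longleftrightarrow> j = k"
proof -
  have "numerical_semigroup (Sekj e k j)"
    using assms by (intro numerical_semigroup_Sekj) auto
  then have "symmetric_semigroup (Sekj e k j) \<longleftrightarrow>
      2 * int ((e - 1) + k + (k + 1 - j)) = int ((if j \<le> k then 2 * e else e) + j + k - 1) + 1"
    unfolding symmetric_semigroup_def genus_Sekj_generic[OF assms(1,3,4,5)]
      frobenius_Sekj_generic[OF assms] by simp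
  also have "\<dots> \<longleftrightarrow> j = k"
    using assms(1-4) by (cases "j \<le> k") (auto simp: of_nat_diff)
  finally show ?thesis .
qed

lemma symmetric_Sekj_exceptional:
  assumes "k \<ge> 2"
  shows "symmetric_semigroup (Sekj (2 * k) k 1)"
proof -
  note gaps = gaps_Sekj_exceptional[OF assms]
  have "card ({1..<2 * k} \<union> {2 * k + 1..3 * k} \<union> {4 * k + 1..5 * k} \<union> {6 * k + 1, 8 * k + 1})
      = card {1..<2 * k} + card {2 * k + 1..3 * k} + card {4 * k + 1..5 * k}
        + card {6 * k + 1, 8 * k + 1}"
    by (subst card_Un_disjoint, simp, simp, force)+ simp
  then have "genus (Sekj (2 * k) k 1) = 4 * k + 1"
    unfolding genus_def gaps using assms by simp
  moreover have "frobenius (Sekj (2 * k) k 1) = int (8 * k + 1)"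
    by (rule frobenius_eqI; unfold gaps; auto)
  moreover have "numerical_semigroup (Sekj (2 * k) k 1)"
    using assms by (intro numerical_semigroup_Sekj) auto
  ultimately show ?thesis
    by (simp add: symmetric_semigroup_def)
qed

theorem theorem3p2:
  fixes e k j :: nat
  assumes "e \<ge> 1" and "k \<ge> 1" and "j \<ge> 1"
    and "j + k \<le> e - 1"
    and "e - k \<ge> 4"
    and "real k \<le> real e / 2"
  shows "((real j, real k) \<noteq> (1, real e / 2) \<longrightarrow>
            (symmetric_semigroup (Sekj e k j) \<longleftrightarrow> j = k)) \<and>
         ((real j, real k) = (1, real e / 2) \<longrightarrow>
            symmetric_semigroup (Sekj e k j))"
proof -
  have "2 * k \<le> e" and "j + k < e"
    using assms by linarith+
  moreover have exceptional: "(real j, real k) = (1, real e / 2) \<longleftrightarrow> j = 1 \<and> e = 2 * k"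
    by auto
  moreover have "k \<ge> 2" if "e = 2 * k"
    using that assms(5) by simp
  ultimately show ?thesis
    using symmetric_Sekj_generic_iff[OF assms(3,2)] symmetric_Sekj_exceptional by auto
qed

end
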